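(* Let $R$ be a commutative ring with $1$, let $d$ be an integer with $1\le d\le 5$, and let $f(x,y,z)\in R[x,y,z]$ be a homogeneous polynomial of degree $d$. Then $f$ admits a linear Pfaffian $R$-representation; that is, there exist $2d\times 2d$ skew-symmetric matrices $A_0,A_1,A_2$ with entries in $R$ such that $$\operatorname{Pf}(xA_0+yA_1+zA_2)=f(x,y,z)\quad\text{in } R[x,y,z].$$
   Context: A square matrix $A=[a_{ij}]$ over a commutative ring is skew-symmetric if $a_{ji}=-a_{ij}$ for all $i,j$ and $a_{ii}=0$ for all $i$. The Pfaffian $\operatorname{Pf}(A)$ of a $2d\times 2d$ skew-symmetric matrix $A=[a_{ij}]$ ($d\ge 1$) with entries in a commutative ring with $1$ is defined recursively by $$\operatorname{Pf}\begin{pmatrix}0&a_{12}\\-a_{12}&0\end{pmatrix}:=a_{12}\quad\text{if } d=1,\qquad \operatorname{Pf}(A):=\sum_{j=2}^{2d}(-1)^j\,a_{1j}\,\operatorname{Pf}\big(A^{[1,j]}\big)\quad\text{if } d\ge 2,$$ where $A^{[1,j]}$ is the $(2d-2)\times(2d-2)$ matrix obtained from $A$ by deleting rows $1$ and $j$ and columns $1$ and $j$. Let $f(x_0,\dots,x_n)\in R[x_0,\dots,x_n]$ be homogeneous of degree $d$. Then $f$ admits a linear Pfaffian $R$-representation if there exist $2d\times 2d$ skew-symmetric matrices $A_0,\dots,A_n$ with entries in $R$ such that $\operatorname{Pf}(x_0A_0+\cdots+x_nA_n)=f(x_0,\dots,x_n)$, where the Pfaffian is taken over the ring $R[x_0,\dots,x_n]$.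 A homogeneous polynomial of degree $d$ means an $R$-linear combination of monomials of total degree $d$ (arbitrary coefficients in $R$). *)

theory Defs
  imports "Jordan_Normal_Form.Determinant" "HOL-Library.Poly_Mapping"
begin

text \<open>
  The coefficient ring is a type of sort \<open>{comm_ring, comm_monoid_mult}\<close>. This is a commutative
  ring with \<open>1\<close>; unlike \<open>comm_ring_1\<close> it does not demand \<open>0 \<noteq> 1\<close>, so the zero ring is included.

  The polynomial ring in the variables \<open>'v\<close> over \<open>'a\<close> is the monoid ring
  \<open>('v \<Rightarrow>\<^sub>0 nat) \<Rightarrow>\<^sub>0 'a\<close>: the inner finite map is the exponent vector of a monomial, the outer one
  assigns the coefficients. Its multiplication is the convolution product of
  \<^theory>\<open>HOL-Library.Poly_Mapping\<close>.
\<close>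

type_synonym ('v, 'a) mpoly = "('v \<Rightarrow>\<^sub>0 nat) \<Rightarrow>\<^sub>0 'a"

datatype xyz = X | Y | Z

definition Var :: "'v \<Rightarrow> ('v, 'a::{zero,one}) mpoly" where
  "Var v = Poly_Mapping.single (Poly_Mapping.single v 1) 1"

definition Const :: "'a::zero \<Rightarrow> ('v, 'a) mpoly" where
  "Const c = Poly_Mapping.single 0 c"

definition homogeneous :: "nat \<Rightarrow> ('v, 'a::zero) mpoly \<Rightarrow> bool" where
  "homogeneous d f \<longleftrightarrow>
     (\<forall>m \<in> Poly_Mapping.keys f. (\<Sum>v \<in> Poly_Mapping.keys m. Poly_Mapping.lookup m v) = d)"

definition skew_symmetric :: "'a::{zero,uminus} mat \<Rightarrow> bool" where
  "skew_symmetric A \<longleftrightarrow> square_mat A \<and>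
     (\<forall>i < dim_row A. \<forall>j < dim_row A. A $$ (j, i) = - A $$ (i, j)) \<and>
     (\<forall>i < dim_row A. A $$ (i, i) = 0)"

text \<open>
  Expansion along the first row. Indices are 0-based, so the column \<open>j\<close> below is column \<open>j + 1\<close>
  in the usual numbering and carries the sign \<open>(-1) ^ (j + 1)\<close>; the sign is written with a case
  distinction because the ring type need not provide a \<open>1\<close>. Index \<open>j\<close> is deleted before
  index \<open>0\<close>, so that it need not be shifted. The value is meaningful only for skew-symmetric
  matrices of positive even dimension.
\<close>

function pfaffian :: "'a::comm_ring mat \<Rightarrow> 'a" where
  "pfaffian A =
     (if dim_row A \<le> 2 then A $$ (0, 1)
      else \<Sum>j = 1..<dim_row A.
             (if odd j then A $$ (0, j) else - A $$ (0, j)) *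
             pfaffian (mat_delete (mat_delete A j j) 0 0))"
  by auto
termination
  by (relation "measure dim_row") (auto simp: mat_delete_def)

declare pfaffian.simps [simp del]

end

theory Submission
  imports Defs
begin

text \<open>
  Consider a matrix of size \<open>2d\<close> with blocks \<open>[[E, M], [- M\<^sup>T, 0]]\<close>, where \<open>E\<close> is skew-symmetric
  of size \<open>d + 1\<close> and \<open>M\<close> has \<open>d + 1\<close> rows and \<open>d - 1\<close> columns. A perfect matching of the indices
  with nonzero weight pairs each of the \<open>d - 1\<close> last indices with one of the first \<open>d + 1\<close>, so it
  uses exactly one entry of \<open>E\<close>. Hence the Pfaffian is linear in \<open>E\<close>, and the coefficient of
  \<open>E\<^sub>i\<^sub>j\<close> is, up to sign, the maximal minor of \<open>M\<close> without the rows \<open>i\<close> and \<open>j\<close>.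

  Take for \<open>M\<close> the Toeplitz matrix with three diagonals \<open>x, - y, z\<close>. It is the matrix of
  multiplication by \<open>x - y t + z t\<^sup>2\<close> on polynomials in \<open>t\<close> of degree below \<open>d - 1\<close>, which is
  injective over a field unless \<open>x = y = z = 0\<close>, so the maximal minors have no common zero but the
  origin. They have degree \<open>d - 1\<close>, there are as many of them as monomials of that degree in three
  variables, and in fact they span all forms of degree \<open>d - 1\<close> over every ring. Since every form of
  degree \<open>d\<close> is a sum of products of a linear form and a form of degree \<open>d - 1\<close>, a suitable \<open>E\<close>
  with linear entries makes the Pfaffian equal to \<open>f\<close>.

  The proof of the spanning property is an induction on the degree, which at the same time produces
  \<open>E\<close>. The indices are ordered so that deleting the first two leaves the same kind of matrix for
  \<open>d - 1\<close>. Expansion along the first row (lemma \<open>list_pfaffian_staircase_Suc\<close>) gives \<open>x\<close> times the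
  Pfaffian for \<open>d - 1\<close>, plus the first row of \<open>E\<close> paired with minors that do not involve \<open>E\<close>.
  Modulo \<open>x\<close> these minors are exactly the monomials of degree \<open>d - 1\<close> in \<open>y\<close> and \<open>z\<close> (lemma
  \<open>minor_toeplitz\<close>). So the first row of \<open>E\<close> can be chosen to produce the part of \<open>f\<close> that is not
  divisible by \<open>x\<close>; the error is \<open>x\<close> times a form of degree \<open>d - 1\<close>, which the induction hypothesis
  absorbs into the remaining rows of \<open>E\<close> (lemma \<open>pfaffian_staircase_surj\<close>).
\<close>

section \<open>Pfaffians of matrices indexed by a list\<close>

text \<open>
  Rows and columns are indexed by the entries of a list, so that deleting an index is deleting a
  list entry and no renumbering is necessary. The alternating sum over the first row passes the
  entries already skipped to the continuation \<open>F\<close>, which sees the list without the current entry.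
\<close>

primrec row_expansion :: "('i \<Rightarrow> 'b::comm_ring) \<Rightarrow> ('i list \<Rightarrow> 'b) \<Rightarrow> 'i list \<Rightarrow> 'b" where
  "row_expansion w F [] = 0"
| "row_expansion w F (p # ps) = w p * F ps - row_expansion w (\<lambda>qs. F (p # qs)) ps"

lemma row_expansion_cong:
  assumes "\<And>us p ws. ps = us @ p # ws \<Longrightarrow> w p * F (us @ ws) = w' p * F' (us @ ws)"
  shows "row_expansion w F ps = row_expansion w' F' ps"
  using assms
proof (induction ps arbitrary: F F')
  case (Cons p ps)
  have "row_expansion w (\<lambda>qs. F (p # qs)) ps = row_expansion w' (\<lambda>qs. F' (p # qs)) ps"
  proof (rule Cons.IH)
    fix us q ws assume "ps = us @ q # ws"
    then show "w q * F (p # us @ ws) = w' q * F' (p # us @ ws)"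
      using Cons.prems[of "p # us" q ws] by simp
  qed
  moreover have "w p * F ps = w' p * F' ps"
    using Cons.prems[of "[]" p ps] by simp
  ultimately show ?case by simp
qed simp

lemma row_expansion_eq_0:
  assumes "\<And>us p ws. ps = us @ p # ws \<Longrightarrow> w p * F (us @ ws) = 0"
  shows "row_expansion w F ps = 0"
proof -
  have zero: "row_expansion (\<lambda>_. 0) G ps = 0" for G :: "'a list \<Rightarrow> 'b"
    by (induction ps arbitrary: G) auto
  have "row_expansion w F ps = row_expansion (\<lambda>_. 0) F ps"
    by (rule row_expansion_cong) (simp add: assms)
  then show ?thesis by (simp add: zero)
qed

lemma row_expansion_zero_row: "(\<And>p. p \<in> set ps \<Longrightarrow> w p = 0) \<Longrightarrow> row_expansion w F ps = 0"
  by (rule row_expansion_eq_0) simp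

text \<open>
  Recursive calls below a row expansion are made on shorter lists only, which is what the
  termination proof of the recursion for the Pfaffian has to know.
\<close>

lemma row_expansion_fundef_cong [fundef_cong]:
  assumes "w = w'" "ps = ps'" "\<And>qs. length qs < length ps' \<Longrightarrow> F qs = F' qs"
  shows "row_expansion w F ps = row_expansion w' F' ps'"
  unfolding assms(1,2) by (rule row_expansion_cong) (simp add: assms(3))

lemma row_expansion_conv_sum:
  "row_expansion w F ps =
     (\<Sum>k<length ps. (if even k then w (ps ! k) else - w (ps ! k)) * F (take k ps @ drop (Suc k) ps))"
proof (induction ps arbitrary: F)
  case (Cons p ps)
  show ?case
    by (simp add: Cons.IH lessThan_Suc_eq_insert_0 sum.reindex flip: sum_negf)
      (auto intro!: sum.cong simp: algebra_simps)
qed simp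

text \<open>
  The sort \<open>comm_ring\<close> does not provide a \<open>1\<close>, so the value on the empty list is a parameter: it is to be a
  neutral element for multiplication, such as the constant polynomial \<open>1\<close>.
\<close>

fun list_pfaffian :: "'b::comm_ring \<Rightarrow> ('i \<Rightarrow> 'i \<Rightarrow> 'b) \<Rightarrow> 'i list \<Rightarrow> 'b" where
  "list_pfaffian u a [] = u"
| "list_pfaffian u a (p # ps) = row_expansion (a p) (list_pfaffian u a) ps"

definition list_matrix :: "('i \<Rightarrow> 'i \<Rightarrow> 'b) \<Rightarrow> 'i list \<Rightarrow> 'b mat" where
  "list_matrix a ps = mat (length ps) (length ps) (\<lambda>(i, j). a (ps ! i) (ps ! j))"

lemma mat_delete_list_matrix:
  assumes "k < length ps"
  shows "mat_delete (list_matrix a ps) k k = list_matrix a (take k ps @ drop (Suc k) ps)"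
  using assms by (intro eq_matI) (auto simp: list_matrix_def mat_delete_def nth_append)

lemma pfaffian_list_matrix:
  assumes "even (length ps)" "ps \<noteq> []" "\<And>b. b * u = b"
  shows "pfaffian (list_matrix a ps) = list_pfaffian u a ps"
  using assms(1,2)
proof (induction ps rule: length_induct)
  case (1 ps)
  then obtain p q rs where ps: "ps = p # q # rs"
    by (cases ps; cases "tl ps") auto
  show ?case
  proof (cases "rs = []")
    case True
    then show ?thesis
      by (subst pfaffian.simps) (simp add: ps list_matrix_def assms(3))
  next
    case False
    define qs where "qs = q # rs"
    have "pfaffian (mat_delete (mat_delete (list_matrix a ps) (Suc k) (Suc k)) 0 0)
        = list_pfaffian u a (take k qs @ drop (Suc k) qs)" if "k < length qs" for k
    proof -
      have "mat_delete (mat_delete (list_matrix a ps) (Suc k) (Suc k)) 0 0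
          = list_matrix a (take k qs @ drop (Suc k) qs)"
        using that ps by (simp add: qs_def mat_delete_list_matrix)
      moreover have "length (take k qs @ drop (Suc k) qs) = length rs"
        using that by (simp add: qs_def)
      ultimately show ?thesis
        using 1 False ps by (metis length_Cons even_Suc less_Suc_eq length_0_conv less_SucI)
    qed
    moreover have "{1..<dim_row (list_matrix a ps)} = Suc ` {..<length qs}"
      by (simp add: list_matrix_def ps qs_def image_Suc_lessThan atLeastLessThanSuc_atLeastAtMost)
    moreover have "\<not> dim_row (list_matrix a ps) \<le> 2"
      using False by (simp add: list_matrix_def ps Suc_le_eq)
    moreover have "list_matrix a ps $$ (0, Suc k) = a p (qs ! k)" if "k < length qs" for k
      using that by (simp add: list_matrix_def ps qs_def)
    ultimately have "pfaffian (list_matrix a ps) = row_expansion (a p) (list_pfaffian u a) qs"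
      by (subst pfaffian.simps)
        (auto simp: sum.reindex row_expansion_conv_sum simp del: mat_delete_dim intro!: sum.cong)
    then show ?thesis by (simp add: ps qs_def)
  qed
qed

section \<open>Block matrices with an isotropic block\<close>

text \<open>
  The indices \<open>R i\<close> number the rows of \<open>M\<close> and the indices \<open>C k\<close> its columns.
\<close>

datatype index = R nat | C nat

fun block :: "(nat \<Rightarrow> nat \<Rightarrow> 'b) \<Rightarrow> (nat \<Rightarrow> nat \<Rightarrow> 'b) \<Rightarrow> index \<Rightarrow> index \<Rightarrow> 'b::{zero,uminus}" where
  "block e m (R i) (R j) = e i j"
| "block e m (R i) (C k) = m i k"
| "block e m (C k) (R i) = - m i k"
| "block e m (C k) (C l) = 0"

abbreviation num_R :: "index list \<Rightarrow> nat" where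
  "num_R ps \<equiv> length (filter (\<lambda>p. \<exists>i. p = R i) ps)"
abbreviation num_C :: "index list \<Rightarrow> nat" where
  "num_C ps \<equiv> length (filter (\<lambda>p. \<exists>k. p = C k) ps)"

text \<open>
  In a perfect matching an index \<open>C k\<close> can only be paired with some \<open>R i\<close>, and there are too few of
  these.
\<close>

lemma list_pfaffian_eq_0:
  assumes "num_R ps < num_C ps"
  shows "list_pfaffian u (block e m) ps = 0"
  using assms
proof (induction ps rule: length_induct)
  case (1 ps)
  then obtain p qs where ps: "ps = p # qs" by (cases ps) auto
  have "row_expansion (block e m p) (list_pfaffian u (block e m)) qs = 0"
  proof (rule row_expansion_eq_0)
    fix us q ws assume qs: "qs = us @ q # ws"
    show "block e m p q * list_pfaffian u (block e m) (us @ ws) = 0"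
    proof (cases "block e m p q = 0")
      case False
      then have "num_R (us @ ws) < num_C (us @ ws)"
        using 1(2) by (cases p; cases q) (auto simp: ps qs)
      then show ?thesis using 1(1) by (simp add: ps qs)
    qed simp
  qed
  then show ?case by (simp add: ps)
qed

text \<open>
  When the two kinds of indices are equally numerous, pairing two indices \<open>R i\<close> and \<open>R j\<close> would leave
  too few partners for the \<open>C k\<close>. So every matching uses entries of \<open>m\<close> only: the Pfaffian is, up to
  sign, the determinant of that block.
\<close>

lemma list_pfaffian_balanced:
  assumes "num_R ps = num_C ps"
  shows "list_pfaffian u (block e m) ps = list_pfaffian u (block e' m) ps"
  using assms
proof (induction ps rule: length_induct)
  case (1 ps)
  show ?case
  proof (cases ps)
    case (Cons p qs)
    have "row_expansion (block e m p) (list_pfaffian u (block e m)) qs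
      = row_expansion (block e' m p) (list_pfaffian u (block e' m)) qs"
    proof (rule row_expansion_cong)
      fix us q ws assume qs: "qs = us @ q # ws"
      show "block e m p q * list_pfaffian u (block e m) (us @ ws)
          = block e' m p q * list_pfaffian u (block e' m) (us @ ws)"
      proof (cases "(\<exists>i. p = R i) \<longleftrightarrow> (\<exists>j. q = R j)")
        case True
        show ?thesis
        proof (cases p)
          case (R i)
          with True have "num_R (us @ ws) < num_C (us @ ws)"
            using 1(2) by (auto simp: Cons qs)
          then show ?thesis by (simp add: list_pfaffian_eq_0)
        next
          case (C k)
          with True show ?thesis by (cases q) auto
        qed
      next
        case False
        then have "num_R (us @ ws) = num_C (us @ ws)" and "block e m p q = block e' m p q"
          using 1(2) by (cases p; cases q; auto simp: Cons qs)+
        then show ?thesis using 1(1) by (simp add: Cons qs)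
      qed
    qed
    then show ?thesis by (simp add: Cons)
  qed simp
qed

lemma list_pfaffian_cong:
  assumes "\<And>p q. p \<in> set ps \<Longrightarrow> q \<in> set ps \<Longrightarrow> a p q = b p q"
  shows "list_pfaffian u a ps = list_pfaffian u b ps"
  using assms
proof (induction ps rule: length_induct)
  case (1 ps)
  show ?case
  proof (cases ps)
    case (Cons p qs)
    have "row_expansion (a p) (list_pfaffian u a) qs = row_expansion (b p) (list_pfaffian u b) qs"
    proof (rule row_expansion_cong)
      fix us q ws assume qs: "qs = us @ q # ws"
      have "list_pfaffian u a (us @ ws) = list_pfaffian u b (us @ ws)"
        using 1 by (simp add: Cons qs)
      then show "a p q * list_pfaffian u a (us @ ws) = b p q * list_pfaffian u b (us @ ws)"
        using 1(2) by (simp add: Cons qs)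
    qed
    then show ?thesis by (simp add: Cons)
  qed simp
qed

section \<open>The banded Toeplitz block\<close>

text \<open>
  Column \<open>k\<close> of this matrix has \<open>x\<close>, \<open>- y\<close>, \<open>z\<close> in the rows \<open>k + 1\<close>, \<open>k\<close>, \<open>k - 1\<close>. The sign of \<open>y\<close> makes the
  minors below equal to monomials modulo \<open>x\<close> without alternating signs.
\<close>

definition band :: "'b \<Rightarrow> 'b \<Rightarrow> 'b \<Rightarrow> nat \<Rightarrow> nat \<Rightarrow> 'b::{zero,uminus}" where
  "band x y z i k = (if i = Suc k then x else if i = k then - y else if Suc i = k then z else 0)"

text \<open>
  The order \<open>R (n + 1), C n, R n, \<dots>, C 1, R 1, R 0\<close> of the \<open>2 * (n + 1)\<close> indices, which belongs to
  forms of degree \<open>n + 1\<close>. Deleting the first two indices passes from \<open>n\<close> to \<open>n - 1\<close>.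
\<close>

primrec staircase :: "nat \<Rightarrow> index list" where
  "staircase 0 = [R 1, R 0]"
| "staircase (Suc n) = R (Suc (Suc n)) # C (Suc n) # staircase n"

lemma length_staircase [simp]: "length (staircase n) = 2 * Suc n"
  by (induction n) auto

lemma R_in_staircase [simp]: "R i \<in> set (staircase n) \<longleftrightarrow> i \<le> Suc n"
  by (induction n) auto

lemma C_in_staircase [simp]: "C k \<in> set (staircase n) \<longleftrightarrow> 0 < k \<and> k \<le> n"
  by (induction n) auto

lemma staircase_Cons: "staircase n = R (Suc n) # removeAll (R (Suc n)) (staircase n)"
  by (cases n) auto

text \<open>
  Two neighbouring indices \<open>R (k + 1), C k\<close> move the position of the following entries by two, hence
  each \<open>R j\<close> is met with a positive sign, except for \<open>R 0\<close>, which directly follows \<open>R 1\<close>.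
\<close>

lemma row_expansion_staircase:
  assumes "\<And>k. 0 < k \<Longrightarrow> k \<le> n \<Longrightarrow> w (C k) = 0"
  shows "row_expansion w F (staircase n) =
    (\<Sum>j = 1..Suc n. w (R j) * F (removeAll (R j) (staircase n))) -
    w (R 0) * F (removeAll (R 0) (staircase n))"
  using assms
proof (induction n arbitrary: F)
  case (Suc n)
  have "row_expansion w (\<lambda>qs. F (R (Suc (Suc n)) # C (Suc n) # qs)) (staircase n) =
    (\<Sum>j = 1..Suc n. w (R j) * F (removeAll (R j) (staircase (Suc n)))) -
    w (R 0) * F (removeAll (R 0) (staircase (Suc n)))"
    by (subst Suc.IH) (auto simp: Suc.prems intro!: sum.cong)
  moreover have "removeAll (R (Suc (Suc n))) (staircase (Suc n)) = C (Suc n) # staircase n"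
    by simp
  ultimately show ?case
    by (simp add: Suc.prems algebra_simps)
qed auto

text \<open>
  Up to sign, the maximal minor of the band matrix with rows \<open>0, \<dots>, n + 1\<close> and columns \<open>1, \<dots>, n + 1\<close>
  from which row \<open>j\<close> is removed. The block \<open>E\<close> is set to zero, because the minor does not depend on it.
  The exceptional sign at \<open>j = 0\<close> cancels the one in \<open>row_expansion_staircase\<close>.
\<close>

definition minor :: "'b::comm_ring \<Rightarrow> (nat \<Rightarrow> nat \<Rightarrow> 'b) \<Rightarrow> nat \<Rightarrow> nat \<Rightarrow> 'b" where
  "minor u m n j =
    (let c = list_pfaffian u (block (\<lambda>_ _. 0) m) (C (Suc n) # removeAll (R j) (staircase n))
     in if j = 0 then c else - c)"

lemma num_staircase:
  "num_C (staircase n) = n" "num_R (staircase n) = Suc (Suc n)"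
  "num_C (removeAll (R j) (staircase n)) = n"
  "j \<le> Suc n \<Longrightarrow> num_R (removeAll (R j) (staircase n)) = Suc n"
  by (induction n) (auto simp: le_Suc_eq)

text \<open>
  In the first row, the only nonzero entry of \<open>M\<close> is the \<open>x\<close> in the second position. The other terms
  pair the first index with some \<open>R j\<close>; after that the two kinds of indices are equally numerous, so
  \<open>E\<close> no longer matters.
\<close>

lemma list_pfaffian_staircase_Suc:
  "list_pfaffian u (block e (band x y z)) (staircase (Suc n)) =
     x * list_pfaffian u (block e (band x y z)) (staircase n) +
     (\<Sum>j\<le>Suc n. e (Suc (Suc n)) j * minor u (band x y z) n j)"
proof -
  let ?a = "block e (band x y z)"
  have minor: "list_pfaffian u ?a (C (Suc n) # removeAll (R j) (staircase n))
      = (if j = 0 then minor u (band x y z) n j else - minor u (band x y z) n j)"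
    if "j \<le> Suc n" for j
    using that list_pfaffian_balanced[of "C (Suc n) # removeAll (R j) (staircase n)" u e "band x y z" "\<lambda>_ _. 0"]
    by (simp add: num_staircase minor_def del: list_pfaffian.simps)
  \<comment> \<open>Row \<open>n + 2\<close> of the band vanishes in the columns up to \<open>n\<close>.\<close>
  have "row_expansion (?a (R (Suc (Suc n)))) (\<lambda>qs. list_pfaffian u ?a (C (Suc n) # qs)) (staircase n)
    = (\<Sum>j = 1..Suc n. e (Suc (Suc n)) j *
        list_pfaffian u ?a (C (Suc n) # removeAll (R j) (staircase n)))
      - e (Suc (Suc n)) 0 * list_pfaffian u ?a (C (Suc n) # removeAll (R 0) (staircase n))"
    by (subst row_expansion_staircase) (simp_all add: band_def del: list_pfaffian.simps)
  also have "\<dots> = (\<Sum>j = 1..Suc n. - (e (Suc (Suc n)) j * minor u (band x y z) n j))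
      - e (Suc (Suc n)) 0 * minor u (band x y z) n 0"
    by (intro arg_cong2[of _ _ _ _ "(-)"] sum.cong)
      (simp_all add: minor del: list_pfaffian.simps)
  also have "\<dots> = - (\<Sum>j\<le>Suc n. e (Suc (Suc n)) j * minor u (band x y z) n j)"
  proof -
    have "{..Suc n} = insert 0 {1..Suc n}" by auto
    then show ?thesis unfolding sum_negf by simp
  qed
  finally show ?thesis
    by (simp add: band_def)
qed

lemma length_removeAll_staircase:
  "j \<le> Suc n \<Longrightarrow> length (removeAll (R j) (staircase n)) = Suc (2 * n)"
  by (induction n) (auto simp: le_Suc_eq)

text \<open>
  Once its last row is removed, the first index \<open>C (n + 2)\<close> meets only the entry \<open>z\<close>.
\<close>

lemma minor_last:
  "minor u (band x y z) (Suc n) (Suc (Suc n)) = z * minor u (band x y z) n (Suc n)"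
proof -
  let ?a = "block (\<lambda>_ _. 0) (band x y z)"
  define D where "D = removeAll (R (Suc n)) (staircase n)"
  have "row_expansion (?a (C (Suc (Suc n)))) F D = 0" for F
  proof (rule row_expansion_zero_row)
    show "?a (C (Suc (Suc n))) p = 0" if "p \<in> set D" for p
      using that by (cases p rule: index.exhaust) (auto simp: D_def band_def)
  qed
  moreover have "removeAll (R (Suc (Suc n))) (staircase (Suc n)) = C (Suc n) # R (Suc n) # D"
    using staircase_Cons[of n] by (simp add: D_def)
  ultimately show ?thesis
    by (simp add: minor_def band_def Let_def del: removeAll.simps flip: D_def)
qed

text \<open>
  If row \<open>n + 2\<close> is present, expansion along \<open>C (n + 2)\<close> has at most two terms, for the entries \<open>- y\<close> and \<open>z\<close>. In
  the second one row \<open>n + 2\<close> is left with \<open>x\<close> as its only nonzero entry, so this term is divisible by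
  \<open>x\<close>. The length of \<open>qs\<close> determines the degree of the cofactor.
\<close>

lemma minor_Suc:
  assumes "j \<le> Suc n"
  shows "\<exists>t qs. (t = 0 \<or> t = z \<or> t = - z) \<and> length qs = 2 * n \<and>
    minor u (band x y z) (Suc n) j = y * minor u (band x y z) n j +
      x * (t * list_pfaffian u (block (\<lambda>_ _. 0) (band x y z)) qs)"
proof -
  let ?a = "block (\<lambda>_ _. 0) (band x y z)"
  define D where "D = removeAll (R (Suc n)) (removeAll (R j) (staircase n))"
  have row_C: "row_expansion (?a (C (Suc (Suc n)))) F D = 0" for F
  proof (rule row_expansion_zero_row)
    show "?a (C (Suc (Suc n))) p = 0" if "p \<in> set D" for p
      using that by (cases p rule: index.exhaust) (auto simp: D_def band_def)
  qed
  show ?thesis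
  proof (cases "j = Suc n")
    case True
    then have "removeAll (R j) (staircase (Suc n)) = R (Suc (Suc n)) # C (Suc n) # D"
      by (simp add: D_def)
    moreover have "removeAll (R j) (staircase n) = D"
      using True by (simp add: D_def)
    ultimately have "minor u (band x y z) (Suc n) j = y * minor u (band x y z) n j + x * (0 * b)" for b
      using row_C by (simp add: minor_def band_def Let_def del: removeAll.simps)
    \<comment> \<open>There is no second term, so any list of the right length serves as \<open>qs\<close>.\<close>
    then show ?thesis
      by (intro exI[of _ 0] exI[of _ "replicate (2 * n) (R 0)"]) simp
  next
    case False
    then have j: "j \<le> n" using assms by simp
    have del: "removeAll (R j) (staircase n) = R (Suc n) # D"
      using j by (subst staircase_Cons) (simp add: D_def removeAll_filter_not_eq conj_commute)
    have row_R: "row_expansion (?a (R (Suc (Suc n)))) F D = 0" for F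
    proof (rule row_expansion_zero_row)
      show "?a (R (Suc (Suc n))) p = 0" if "p \<in> set D" for p
        using that by (cases p rule: index.exhaust) (auto simp: D_def band_def)
    qed
    have "removeAll (R j) (staircase (Suc n)) = R (Suc (Suc n)) # C (Suc n) # R (Suc n) # D"
      using j del by simp
    then have "minor u (band x y z) (Suc n) j = y * minor u (band x y z) n j +
        x * ((if j = 0 then - z else z) * list_pfaffian u ?a D)"
      using row_C row_R del
      by (simp add: minor_def band_def Let_def algebra_simps del: removeAll.simps)
    moreover have "length D = 2 * n"
      using length_removeAll_staircase[of j n] j del by simp
    ultimately show ?thesis
      by (intro exI[of _ "if j = 0 then - z else z"] exI[of _ D]) simp
  qed
qed

section \<open>Homogeneous polynomials\<close>

lemma homogeneous_0: "homogeneous d 0"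
  by (simp add: homogeneous_def)

lemma homogeneous_add: "homogeneous d f \<Longrightarrow> homogeneous d g \<Longrightarrow> homogeneous d (f + g)"
  unfolding homogeneous_def using keys_add[of f g] by blast

lemma homogeneous_uminus: "homogeneous d (f :: ('v, 'a::ab_group_add) mpoly) \<Longrightarrow> homogeneous d (- f)"
  by (auto simp: homogeneous_def in_keys_iff)

lemma homogeneous_diff:
  "homogeneous d f \<Longrightarrow> homogeneous d g \<Longrightarrow> homogeneous d (f - g :: ('v, 'a::ab_group_add) mpoly)"
  by (metis homogeneous_add homogeneous_uminus diff_conv_add_uminus)

lemma homogeneous_sum:
  "(\<And>i. i \<in> I \<Longrightarrow> homogeneous d (f i)) \<Longrightarrow> homogeneous d (\<Sum>i\<in>I. f i)"
  by (induction I rule: infinite_finite_induct) (auto simp: homogeneous_0 homogeneous_add)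

lemma homogeneous_mult:
  fixes f g :: "('v, 'a::semiring_0) mpoly"
  assumes "homogeneous d f" "homogeneous d' g"
  shows "homogeneous (d + d') (f * g)"
  unfolding homogeneous_def
proof
  fix m assume "m \<in> Poly_Mapping.keys (f * g)"
  then obtain k l where "m = k + l" "k \<in> Poly_Mapping.keys f" "l \<in> Poly_Mapping.keys g"
    using keys_mult by blast
  then show "(\<Sum>v\<in>Poly_Mapping.keys m. Poly_Mapping.lookup m v) = d + d'"
    using assms setsum_keys_plus_distrib[of "\<lambda>_ a. a" k l] by (simp add: homogeneous_def)
qed

lemma homogeneous_Const: "homogeneous 0 (Const c)"
  by (simp add: homogeneous_def Const_def)

lemma homogeneous_Var: "homogeneous 1 (Var v)"
  by (simp add: homogeneous_def Var_def)

lemma sum_single_lookup: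
  "(\<Sum>m\<in>Poly_Mapping.keys f. Poly_Mapping.single m (Poly_Mapping.lookup f m)) = f"
  by (intro poly_mapping_eqI) (simp add: lookup_sum lookup_single when_def in_keys_iff)

lemma homogeneous_induct [consumes 1, case_names zero add monomial]:
  fixes f :: "('v, 'a::comm_monoid_add) mpoly"
  assumes "homogeneous d f" and "P 0" and "\<And>f g. P f \<Longrightarrow> P g \<Longrightarrow> P (f + g)"
    and "\<And>m c. (\<Sum>v\<in>Poly_Mapping.keys m. Poly_Mapping.lookup m v) = d \<Longrightarrow> P (Poly_Mapping.single m c)"
  shows "P f"
proof -
  have "P (\<Sum>m\<in>M. Poly_Mapping.single m (Poly_Mapping.lookup f m))" if "M \<subseteq> Poly_Mapping.keys f" for M
    using finite_subset[OF that finite_keys] that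
    by (induction M rule: finite_induct) (use assms in \<open>auto simp: homogeneous_def\<close>)
  from this[OF order_refl] show ?thesis by (simp add: sum_single_lookup)
qed

lemma homogeneous_list_pfaffian:
  fixes a :: "'i \<Rightarrow> 'i \<Rightarrow> ('v, 'a::comm_ring) mpoly"
  assumes "length ps = 2 * n" "homogeneous 0 u"
    "\<And>p q. homogeneous 1 (a p q)"
  shows "homogeneous n (list_pfaffian u a ps)"
  using assms(1)
proof (induction n arbitrary: ps)
  case (Suc n)
  then obtain p qs where ps: "ps = p # qs" and qs: "length qs = Suc (2 * n)"
    by (cases ps) auto
  have "homogeneous (Suc n) ((if even k then a p (qs ! k) else - a p (qs ! k)) *
      list_pfaffian u a (take k qs @ drop (Suc k) qs))" if "k < length qs" for k
  proof -
    have "homogeneous n (list_pfaffian u a (take k qs @ drop (Suc k) qs))"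
      by (rule Suc.IH) (use that qs in auto)
    then show ?thesis
      using homogeneous_mult[OF assms(3)[of p "qs ! k"]] homogeneous_uminus by fastforce
  qed
  then show ?case
    by (auto simp: ps row_expansion_conv_sum intro: homogeneous_sum)
qed (simp add: assms)

section \<open>Forms in three variables\<close>

lemma degree_xyz:
  "(\<Sum>v\<in>Poly_Mapping.keys m. Poly_Mapping.lookup m v) =
    Poly_Mapping.lookup m X + Poly_Mapping.lookup m Y + (Poly_Mapping.lookup m Z :: nat)"
proof -
  have UNIV: "(UNIV :: xyz set) = {X, Y, Z}"
    using xyz.exhaust by auto
  then have "finite (UNIV :: xyz set)"
    by (metis finite.emptyI finite_insert)
  then have "(\<Sum>v\<in>Poly_Mapping.keys m. Poly_Mapping.lookup m v) = (\<Sum>v\<in>UNIV. Poly_Mapping.lookup m v)"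
    by (intro sum.mono_neutral_left) (auto simp: in_keys_iff)
  then show ?thesis by (simp add: UNIV)
qed

definition linear_form :: "(xyz \<Rightarrow> 'a) \<Rightarrow> (xyz, 'a::{comm_ring,comm_monoid_mult}) mpoly" where
  "linear_form c = Var X * Const (c X) + Var Y * Const (c Y) + Var Z * Const (c Z)"

lemma homogeneous_linear_form: "homogeneous 1 (linear_form c)"
proof -
  have "homogeneous 1 (Var v * Const a :: (xyz, 'a) mpoly)" for v a
    using homogeneous_mult[OF homogeneous_Var homogeneous_Const, of v a] by simp
  then show ?thesis
    unfolding linear_form_def by (intro homogeneous_add)
qed

lemma linear_form_add: "linear_form c + linear_form c' = linear_form (\<lambda>v. c v + c' v)"
  by (simp add: linear_form_def Const_def single_add algebra_simps)

lemma linear_form_uminus: "- linear_form c = linear_form (\<lambda>v. - c v)"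
  by (simp add: linear_form_def Const_def single_uminus algebra_simps)

lemma linear_form_0: "linear_form (\<lambda>_. 0) = 0"
  by (simp add: linear_form_def Const_def)

lemma linear_form_band:
  "linear_form (\<lambda>v. band (if v = X then 1 else 0) (if v = Y then 1 else 0) (if v = Z then 1 else 0) i k)
   = band (Var X) (Var Y) (Var Z) i k"
  by (simp add: band_def linear_form_def Var_def Const_def mult_single single_uminus)

lemma linear_form_block:
  "linear_form (\<lambda>v. block (e v) (m v) p q) =
   block (\<lambda>i j. linear_form (\<lambda>v. e v i j)) (\<lambda>i k. linear_form (\<lambda>v. m v i k)) p q"
  by (cases "(\<lambda>i j. linear_form (\<lambda>v. e v i j), \<lambda>i k. linear_form (\<lambda>v. m v i k), p, q)" rule: block.cases)
    (simp_all add: linear_form_uminus linear_form_0)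

lemma mult_Const_1: "f * Const 1 = f"
  for f :: "('v, 'a::{comm_ring,comm_monoid_mult}) mpoly"
proof -
  have "(\<Sum>m\<in>M. Poly_Mapping.single m (Poly_Mapping.lookup f m)) * Const 1 =
      (\<Sum>m\<in>M. Poly_Mapping.single m (Poly_Mapping.lookup f m))" for M
    by (simp add: sum_distrib_right Const_def mult_single)
  from this[of "Poly_Mapping.keys f"] show ?thesis by (simp only: sum_single_lookup)
qed

definition yz_monomial :: "nat \<Rightarrow> nat \<Rightarrow> (xyz, 'a::{comm_ring,comm_monoid_mult}) mpoly" where
  "yz_monomial a b = Poly_Mapping.single (Poly_Mapping.single Y a + Poly_Mapping.single Z b) 1"

lemma Var_mult_yz_monomial:
  "Var Y * yz_monomial a b = yz_monomial (Suc a) b"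
  "Var Z * yz_monomial a b = yz_monomial a (Suc b)"
proof -
  have "Poly_Mapping.single v (Suc a) = Poly_Mapping.single v 1 + Poly_Mapping.single v a" for v :: xyz and a
    by (simp flip: single_add)
  then show "Var Y * yz_monomial a b = yz_monomial (Suc a) b"
    "Var Z * yz_monomial a b = yz_monomial a (Suc b)"
    by (simp_all only: Var_def yz_monomial_def mult_single ac_simps mult_1)
qed

lemma homogeneous_1_linear_form:
  assumes "homogeneous 1 f"
  shows "\<exists>c. f = linear_form c"
  using assms
proof (induction rule: homogeneous_induct)
  case zero
  then show ?case by (metis linear_form_0)
next
  case (add f g)
  then show ?case by (metis linear_form_add)
next
  case (monomial m c)
  then have deg: "Poly_Mapping.lookup m X + Poly_Mapping.lookup m Y + Poly_Mapping.lookup m Z = 1"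
    by (simp add: degree_xyz)
  define v where "v = (if Poly_Mapping.lookup m X = 1 then X else if Poly_Mapping.lookup m Y = 1 then Y else Z)"
  have "m = Poly_Mapping.single v 1"
  proof (rule poly_mapping_eqI)
    show "Poly_Mapping.lookup m w = Poly_Mapping.lookup (Poly_Mapping.single v 1) w" for w
      using deg by (cases w) (auto simp: v_def lookup_single)
  qed
  then have "Poly_Mapping.single m c = linear_form (\<lambda>w. if w = v then c else 0)"
    by (cases v) (simp_all add: linear_form_def Var_def Const_def mult_single)
  then show ?case by blast
qed

text \<open>
  Monomials divisible by \<open>x\<close> go into \<open>g\<close>. A monomial \<open>y\<^sup>a z\<^sup>b\<close> with \<open>a > 0\<close> is \<open>y\<close> times the monomial with
  index \<open>j = b\<close>, and \<open>z\<^bsup>d + 1\<^esup>\<close>, which is not divisible by \<open>y\<close>, is \<open>z\<close> times the monomial with index \<open>j = d\<close>.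
\<close>

lemma homogeneous_decomp:
  assumes "homogeneous (Suc d) f"
  shows "\<exists>g c. homogeneous d g \<and>
    f = Var X * g + (\<Sum>j\<le>d. linear_form (c j) * yz_monomial (d - j) j)"
  using assms
proof (induction rule: homogeneous_induct)
  case zero
  show ?case
    by (rule exI[of _ 0], rule exI[of _ "\<lambda>_ _. 0"]) (simp add: homogeneous_0 linear_form_0)
next
  case (add f f')
  then obtain g c g' c' where "homogeneous d g" "homogeneous d g'"
    and "f = Var X * g + (\<Sum>j\<le>d. linear_form (c j) * yz_monomial (d - j) j)"
    and "f' = Var X * g' + (\<Sum>j\<le>d. linear_form (c' j) * yz_monomial (d - j) j)"
    by blast
  then show ?case
    by (intro exI[of _ "g + g'"] exI[of _ "\<lambda>j v. c j v + c' j v"])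
      (simp add: homogeneous_add algebra_simps sum.distrib flip: linear_form_add)
next
  case (monomial m a)
  then have deg: "Poly_Mapping.lookup m X + Poly_Mapping.lookup m Y + Poly_Mapping.lookup m Z = Suc d"
    by (simp add: degree_xyz)
  show ?case
  proof (cases "Poly_Mapping.lookup m X = 0")
    case False
    define k where "k = m - Poly_Mapping.single X 1"
    have m: "m = Poly_Mapping.single X 1 + k"
      using False by (intro poly_mapping_eqI)
        (simp add: k_def lookup_add minus_poly_mapping.rep_eq lookup_single when_def)
    have "Var X * Poly_Mapping.single k a = Poly_Mapping.single m a"
      by (simp add: Var_def mult_single m)
    moreover have "homogeneous d (Poly_Mapping.single k a)"
      using deg unfolding homogeneous_def by (auto simp: degree_xyz m lookup_add lookup_single)
    ultimately show ?thesis
      by (intro exI[of _ "Poly_Mapping.single k a"] exI[of _ "\<lambda>_ _. 0"]) (simp add: linear_form_0)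
  next
    case True
    \<comment> \<open>\<open>v\<close> is the variable that is split off, and \<open>i\<close> is the exponent of \<open>z\<close> that remains.\<close>
    define i where "i = (if Poly_Mapping.lookup m Y = 0 then d else Poly_Mapping.lookup m Z)"
    define v where "v = (if Poly_Mapping.lookup m Y = 0 then Z else Y)"
    have "i \<le> d" using deg True by (auto simp: i_def)
    have "m = Poly_Mapping.single v 1 + (Poly_Mapping.single Y (d - i) + Poly_Mapping.single Z i)"
    proof (rule poly_mapping_eqI)
      fix w show "Poly_Mapping.lookup m w = Poly_Mapping.lookup (Poly_Mapping.single v 1 + (Poly_Mapping.single Y (d - i) + Poly_Mapping.single Z i)) w"
        using deg True by (cases w) (auto simp: v_def i_def lookup_add lookup_single)
    qed
    then have "Poly_Mapping.single m a = linear_form (\<lambda>w. if w = v then a else 0) * yz_monomial (d - i) i"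
      by (cases v) (simp_all add: linear_form_def Var_def Const_def yz_monomial_def mult_single)
    also have "\<dots> = (\<Sum>j\<le>d. linear_form (if j = i then (\<lambda>w. if w = v then a else 0) else (\<lambda>_. 0))
        * yz_monomial (d - j) j)"
      using \<open>i \<le> d\<close> by (subst sum.remove[of _ i]) (simp_all add: linear_form_0)
    finally show ?thesis
      by (intro exI[of _ 0] exI) (simp add: homogeneous_0)
  qed
qed

section \<open>Linear Pfaffian representations of ternary forms\<close>

abbreviation toeplitz :: "nat \<Rightarrow> nat \<Rightarrow> (xyz, 'a::{comm_ring,comm_monoid_mult}) mpoly" where
  "toeplitz \<equiv> band (Var X) (Var Y) (Var Z)"

lemma homogeneous_block_toeplitz:
  "homogeneous 1 (block (\<lambda>_ _. 0) toeplitz p q)"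
  by (cases p; cases q)
    (simp_all add: homogeneous_0 homogeneous_uminus homogeneous_linear_form[simplified] flip: linear_form_band)

text \<open>
  Modulo \<open>x\<close> the band matrix is bidiagonal, and removing row \<open>j\<close> leaves two triangular blocks: one
  contributes an entry \<open>y\<close> for each row with a larger index, the other an entry \<open>z\<close> for each row with
  a smaller index. The remainder has to be homogeneous because it is to be represented by induction.
\<close>

lemma minor_toeplitz:
  assumes "j \<le> Suc n"
  shows "\<exists>t :: (xyz, 'a::{comm_ring,comm_monoid_mult}) mpoly. homogeneous n t \<and>
    minor (Const 1) toeplitz n j = yz_monomial (Suc n - j) j + Var X * t"
  using assms
proof (induction n arbitrary: j)
  case 0
  then consider "j = 0" | "j = 1" by linarith
  then have "minor (Const 1) toeplitz 0 j = (yz_monomial (Suc 0 - j) j :: (xyz, 'a) mpoly)"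
    by cases (simp_all add: minor_def band_def mult_Const_1 yz_monomial_def Var_def)
  then show ?case
    by (intro exI[of _ 0]) (simp add: homogeneous_0)
next
  case (Suc n)
  show ?case
  proof (cases "j = Suc (Suc n)")
    case True
    from Suc.IH[of "Suc n"] obtain t :: "(xyz, 'a) mpoly" where "homogeneous n t"
      and "minor (Const 1) toeplitz n (Suc n) = yz_monomial 0 (Suc n) + Var X * t"
      by auto
    then show ?thesis
      using homogeneous_mult[OF homogeneous_Var[of Z], of n t]
      by (intro exI[of _ "Var Z * t"])
        (simp add: True minor_last Var_mult_yz_monomial algebra_simps)
  next
    case False
    with Suc.prems have j: "j \<le> Suc n" by simp
    obtain t :: "(xyz, 'a) mpoly" where "homogeneous n t"
      and t: "minor (Const 1) toeplitz n j = yz_monomial (Suc n - j) j + Var X * t"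
      using Suc.IH[OF j] by blast
    obtain c :: "(xyz, 'a) mpoly" and qs where c: "c = 0 \<or> c = Var Z \<or> c = - Var Z" and "length qs = 2 * n"
      and eq: "minor (Const 1) toeplitz (Suc n) j = Var Y * minor (Const 1) toeplitz n j +
        Var X * (c * list_pfaffian (Const 1) (block (\<lambda>_ _. 0) toeplitz) qs)"
      using minor_Suc[OF j] by blast
    define s where "s = Var Y * t + c * list_pfaffian (Const 1) (block (\<lambda>_ _. 0) toeplitz) qs"
    have "homogeneous 1 c"
      using c by (auto simp: homogeneous_0 homogeneous_uminus homogeneous_Var[simplified])
    moreover have "homogeneous n (list_pfaffian (Const 1) (block (\<lambda>_ _. 0) toeplitz) qs)"
      by (intro homogeneous_list_pfaffian homogeneous_block_toeplitz homogeneous_Const) fact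
    ultimately have "homogeneous (1 + n) s"
      unfolding s_def by (intro homogeneous_add homogeneous_mult homogeneous_Var \<open>homogeneous n t\<close>)
    moreover have "minor (Const 1) toeplitz (Suc n) j = yz_monomial (Suc (Suc n) - j) j + Var X * s"
      using j by (simp add: eq t s_def Suc_diff_le algebra_simps flip: Var_mult_yz_monomial)
    ultimately show ?thesis by auto
  qed
qed

text \<open>
  In the order of the staircase larger indices come first, so the entries \<open>e i j\<close> with \<open>j < i\<close> are
  those above the diagonal of the matrix.
\<close>

definition skew :: "(nat \<Rightarrow> nat \<Rightarrow> 'a) \<Rightarrow> nat \<Rightarrow> nat \<Rightarrow> 'a::{zero,uminus}" where
  "skew e i j = (if j < i then e i j else if i < j then - e j i else 0)"

text \<open>
  The map from \<open>E\<close> to the Pfaffian is onto the forms of degree \<open>n + 1\<close>. The row of \<open>E\<close> with index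
  \<open>n + 2\<close> is chosen from the part of \<open>f\<close> without \<open>x\<close>; besides that part it
  contributes a multiple of \<open>x\<close>, which is known before the rows with smaller index are chosen.
\<close>

lemma pfaffian_staircase_surj:
  fixes f :: "(xyz, 'a::{comm_ring,comm_monoid_mult}) mpoly"
  assumes "homogeneous (Suc n) f"
  shows "\<exists>e :: xyz \<Rightarrow> nat \<Rightarrow> nat \<Rightarrow> 'a.
    list_pfaffian (Const 1) (block (\<lambda>i j. linear_form (\<lambda>v. skew (e v) i j)) toeplitz) (staircase n) = f"
  using assms
proof (induction n arbitrary: f)
  case 0
  then obtain c where "f = linear_form c"
    using homogeneous_1_linear_form by auto
  then show ?case
    by (intro exI[of _ "\<lambda>v _ _. c v"]) (simp add: skew_def mult_Const_1)
next
  case (Suc n)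
  obtain g c where g: "homogeneous (Suc n) g"
    and f: "f = Var X * g + (\<Sum>j\<le>Suc n. linear_form (c j) * yz_monomial (Suc n - j) j)"
    using homogeneous_decomp[OF Suc.prems] by blast
  have "\<forall>j\<in>{..Suc n}. \<exists>t :: (xyz, 'a) mpoly. homogeneous n t \<and>
      minor (Const 1) toeplitz n j = yz_monomial (Suc n - j) j + Var X * t"
    using minor_toeplitz by auto
  from bchoice[OF this] obtain t :: "nat \<Rightarrow> (xyz, 'a) mpoly"
    where t: "\<And>j. j \<le> Suc n \<Longrightarrow> homogeneous n (t j)"
      and minor: "\<And>j. j \<le> Suc n \<Longrightarrow>
        minor (Const 1) toeplitz n j = yz_monomial (Suc n - j) j + Var X * t j"
    by auto
  \<comment> \<open>The remainders \<open>t j\<close> of the minors are subtracted from \<open>g\<close> in advance.\<close>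
  have "homogeneous (Suc n) (g - (\<Sum>j\<le>Suc n. linear_form (c j) * t j))"
    using homogeneous_mult[OF homogeneous_linear_form t]
    by (intro homogeneous_diff g homogeneous_sum) simp
  from Suc.IH[OF this] obtain e where e:
    "list_pfaffian (Const 1) (block (\<lambda>i j. linear_form (\<lambda>v. skew (e v) i j)) toeplitz) (staircase n)
      = g - (\<Sum>j\<le>Suc n. linear_form (c j) * t j)" by blast
  define e' where "e' v i j = (if i = Suc (Suc n) then c j v else e v i j)" for v i j
  let ?a = "block (\<lambda>i j. linear_form (\<lambda>v. skew (e' v) i j)) toeplitz"
  have old_rows: "skew (e' v) i j = skew (e v) i j" if "i \<le> Suc n" "j \<le> Suc n" for v i j
    using that by (auto simp: e'_def skew_def)
  have "list_pfaffian (Const 1) ?a (staircase n)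
      = list_pfaffian (Const 1) (block (\<lambda>i j. linear_form (\<lambda>v. skew (e v) i j)) toeplitz) (staircase n)"
  proof (rule list_pfaffian_cong)
    fix p q assume "p \<in> set (staircase n)" "q \<in> set (staircase n)"
    then show "?a p q = block (\<lambda>i j. linear_form (\<lambda>v. skew (e v) i j)) toeplitz p q"
      by (cases p rule: index.exhaust; cases q rule: index.exhaust) (simp_all add: old_rows)
  qed
  moreover have "linear_form (\<lambda>v. skew (e' v) (Suc (Suc n)) j) = linear_form (c j)" if "j \<le> Suc n" for j
    using that by (simp add: e'_def skew_def)
  ultimately have "list_pfaffian (Const 1) ?a (staircase (Suc n)) =
      Var X * (g - (\<Sum>j\<le>Suc n. linear_form (c j) * t j)) +
      (\<Sum>j\<le>Suc n. linear_form (c j) * (yz_monomial (Suc n - j) j + Var X * t j))"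
    unfolding list_pfaffian_staircase_Suc
    by (intro arg_cong2[of _ _ _ _ "(+)"] sum.cong) (simp_all add: e minor)
  also have "\<dots> = f"
    by (simp only: f distrib_left right_diff_distrib sum.distrib sum_distrib_left mult.left_commute) simp
  finally show ?case by blast
qed

lemma linear_pfaffian_representation:
  fixes f :: "(xyz, 'a::{comm_ring, comm_monoid_mult}) mpoly"
  assumes "0 < d" and "homogeneous d f"
  shows "\<exists>A :: xyz \<Rightarrow> 'a mat. (\<forall>v. A v \<in> carrier_mat (2 * d) (2 * d) \<and> skew_symmetric (A v)) \<and>
    pfaffian (Var X \<cdot>\<^sub>m map_mat Const (A X) + Var Y \<cdot>\<^sub>m map_mat Const (A Y)
              + Var Z \<cdot>\<^sub>m map_mat Const (A Z)) = f"
proof -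
  obtain n where d: "d = Suc n" using assms(1) by (cases d) auto
  obtain e :: "xyz \<Rightarrow> nat \<Rightarrow> nat \<Rightarrow> 'a" where e:
    "list_pfaffian (Const 1) (block (\<lambda>i j. linear_form (\<lambda>v. skew (e v) i j)) toeplitz) (staircase n) = f"
    using pfaffian_staircase_surj assms(2) unfolding d by blast
  define b :: "xyz \<Rightarrow> index \<Rightarrow> index \<Rightarrow> 'a" where
    "b v = block (skew (e v))
      (band (if v = X then 1 else 0) (if v = Y then 1 else 0) (if v = Z then 1 else 0))" for v
  define A where "A v = list_matrix (b v) (staircase n)" for v
  have skew: "b v q p = - b v p q" "b v p p = 0" for v p q
    by (cases p; cases q; simp add: b_def skew_def)+
  have "A v \<in> carrier_mat (2 * d) (2 * d)" "skew_symmetric (A v)" for v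
    by (auto simp: A_def d list_matrix_def skew_symmetric_def skew(2) intro: skew(1))
  moreover have "Var X \<cdot>\<^sub>m map_mat Const (A X) + Var Y \<cdot>\<^sub>m map_mat Const (A Y)
        + Var Z \<cdot>\<^sub>m map_mat Const (A Z) = list_matrix (\<lambda>p q. linear_form (\<lambda>v. b v p q)) (staircase n)"
    by (intro eq_matI) (simp_all add: A_def list_matrix_def linear_form_def)
  moreover have "(\<lambda>p q. linear_form (\<lambda>v. b v p q)) =
      block (\<lambda>i j. linear_form (\<lambda>v. skew (e v) i j)) toeplitz"
    unfolding b_def by (intro ext) (simp only: linear_form_block linear_form_band)
  moreover have "pfaffian (list_matrix a (staircase n)) = list_pfaffian (Const 1) a (staircase n)"
    for a :: "index \<Rightarrow> index \<Rightarrow> (xyz, 'a) mpoly"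
    by (rule pfaffian_list_matrix) (auto simp: mult_Const_1 simp flip: length_0_conv)
  ultimately show ?thesis
    using e by (intro exI[of _ A]) simp
qed

theorem theorem1p1:
  fixes f :: "(xyz, 'a::{comm_ring, comm_monoid_mult}) mpoly" and d :: nat
  assumes "1 \<le> d" and "d \<le> 5" and "homogeneous d f"
  shows "\<exists>A0 A1 A2 :: 'a mat.
    A0 \<in> carrier_mat (2 * d) (2 * d) \<and> skew_symmetric A0 \<and>
    A1 \<in> carrier_mat (2 * d) (2 * d) \<and> skew_symmetric A1 \<and>
    A2 \<in> carrier_mat (2 * d) (2 * d) \<and> skew_symmetric A2 \<and>
    pfaffian (Var X \<cdot>\<^sub>m map_mat Const A0 + Var Y \<cdot>\<^sub>m map_mat Const A1
              + Var Z \<cdot>\<^sub>m map_mat Const A2) = f"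
proof -
  obtain A :: "xyz \<Rightarrow> 'a mat" where
    "\<And>v. A v \<in> carrier_mat (2 * d) (2 * d) \<and> skew_symmetric (A v)"
    "pfaffian (Var X \<cdot>\<^sub>m map_mat Const (A X) + Var Y \<cdot>\<^sub>m map_mat Const (A Y)
              + Var Z \<cdot>\<^sub>m map_mat Const (A Z)) = f"
    using linear_pfaffian_representation[of d f] assms(1,3) by auto
  then show ?thesis by blast
qed

end
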